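(* For all positive integers $h$, \[ \mathcal{R}_{\mathbb{Z}}(h,3) = \left\{ \binom{h+2}{2} - \binom{t}{2} : t\in[1,h] \right\}. \]
   Context: For real $u,v$, $[u,v]=\{c\in\mathbb{Z}: u\le c\le v\}$. For a nonempty set $A$ of integers and a positive integer $h$, $hA=\{a_1+\cdots+a_h : a_i\in A\}$ (summands not necessarily distinct). $\mathcal{R}_{\mathbb{Z}}(h,k)=\{|hA| : A\subseteq \mathbb{Z},\ |A|=k\}$. Here $\binom{1}{2}=0$. *)

theory Defs
  imports Complex_Main
begin

definition hfold_sumset :: "nat \<Rightarrow> int set \<Rightarrow> int set" where
  "hfold_sumset h A = {\<Sum>i<h. a i | a :: nat \<Rightarrow> int. \<forall>i<h. a i \<in> A}"

(* The finiteness condition matters only for k = 0, because card is 0 on infinite sets. *)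
definition sumset_sizes_int :: "nat \<Rightarrow> nat \<Rightarrow> nat set" where
  "sumset_sizes_int h k = {card (hfold_sumset h A) | A :: int set. finite A \<and> card A = k}"

end

theory Submission
  imports Defs
begin

text \<open>
  A three-element set of integers has the form \<open>{x, x + d u, x + d v}\<close> with \<open>d > 0\<close>, \<open>0 < u < v\<close>
  and \<open>u\<close>, \<open>v\<close> coprime, so its \<open>h\<close>-fold sumset is a copy of the set of values \<open>i u + j v\<close> on the
  triangle \<open>i + j \<le> h\<close>. Trading \<open>v\<close> copies of \<open>u\<close> for \<open>u\<close> copies of \<open>v\<close> preserves the value and
  stays in the triangle because \<open>u < v\<close>; by coprimality each value has exactly one representative
  with \<open>i < v\<close>. The discarded points \<open>i \<ge> v\<close> form a smaller triangle with
  \<open>t choose 2\<close> points, where \<open>t = h + 2 - v\<close> (or \<open>t = 1\<close> when \<open>v > h\<close>).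
\<close>

text \<open>The bound is strict so that \<open>triangle 0\<close> is empty; the points with i + j
  \<le> h form \<open>triangle (Suc h)\<close>.\<close>

definition triangle :: "nat \<Rightarrow> (nat \<times> nat) set" where
  "triangle n = {(i, j). i + j < n}"

lemma finite_triangle: "finite (triangle n)"
  by (rule finite_subset[of _ "{..<n} \<times> {..<n}"]) (auto simp: triangle_def)

lemma card_triangle: "card (triangle n) = Suc n choose 2"
proof (induction n)
  case 0
  then show ?case by (simp add: triangle_def)
next
  case (Suc n)
  \<comment> \<open>The antidiagonal i + j = n, the only layer added in passing from
    \<open>n\<close> to \<open>Suc n\<close>.\<close>
  let ?D = "(\<lambda>i. (i, n - i)) ` {..n}"
  have split: "triangle (Suc n) = triangle n \<union> ?D"
    by (fastforce simp: triangle_def image_iff)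
  have "card (triangle (Suc n)) = card (triangle n) + card ?D"
    unfolding split by (rule card_Un_disjoint) (auto simp: finite_triangle, auto simp: triangle_def)
  also have "card ?D = Suc n"
    by (subst card_image) (auto simp: inj_on_def)
  finally show ?case
    using Suc by (simp add: numeral_2_eq_2)
qed

text \<open>The points cut off, those with i \<ge> v, are \<open>triangle (n - v)\<close> shifted by
  v in the first coordinate. If v \<ge> n, truncated subtraction makes that triangle empty, in
  accordance with \<open>1 choose 2\<close> being 0.\<close>

lemma card_truncated_triangle:
  "int (card {(i, j). i < v \<and> i + j < n}) = int (Suc n choose 2) - int (Suc (n - v) choose 2)"
proof -
  let ?S = "(\<lambda>(i, j). (i + v, j)) ` triangle (n - v)"
  have S: "?S = {(i, j). v \<le> i \<and> i + j < n}"
  proof (intro set_eqI iffI; clarify)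
    fix i j assume "v \<le> i" "i + j < n"
    then show "(i, j) \<in> ?S"
      by (intro image_eqI[of _ _ "(i - v, j)"]) (auto simp: triangle_def)
  qed (auto simp: triangle_def)
  have "{(i, j). i < v \<and> i + j < n} = triangle n - ?S"
    unfolding S by (auto simp: triangle_def)
  moreover have "?S \<subseteq> triangle n"
    unfolding S by (auto simp: triangle_def)
  moreover have "card ?S = card (triangle (n - v))"
    by (rule card_image) (auto simp: inj_on_def)
  ultimately show ?thesis
    using card_mono[OF finite_triangle, of ?S n]
    by (simp add: card_Diff_subset finite_subset[OF _ finite_triangle] card_triangle of_nat_diff)
qed

lemma hfold_sumset_0: "hfold_sumset 0 A = {0}"
  by (simp add: hfold_sumset_def)

lemma hfold_sumset_Suc: "hfold_sumset (Suc h) A = {s + a | s a. s \<in> hfold_sumset h A \<and> a \<in> A}"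
proof (intro set_eqI iffI)
  fix y assume "y \<in> hfold_sumset (Suc h) A"
  then show "y \<in> {s + a | s a. s \<in> hfold_sumset h A \<and> a \<in> A}"
    unfolding hfold_sumset_def by fastforce
next
  fix y assume "y \<in> {s + a | s a. s \<in> hfold_sumset h A \<and> a \<in> A}"
  then obtain f a where f: "\<forall>i<h. f i \<in> A" "a \<in> A" "y = (\<Sum>i<h. f i) + a"
    unfolding hfold_sumset_def by auto
  then have "y = (\<Sum>i<Suc h. (f(h := a)) i)" "\<forall>i<Suc h. (f(h := a)) i \<in> A"
    by (auto simp: less_Suc_eq)
  then show "y \<in> hfold_sumset (Suc h) A"
    unfolding hfold_sumset_def by blast
qed

text \<open>Here i counts the summands equal to x + p and j those equal to x + q; the other h - i -
  j summands are x.\<close>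

lemma hfold_sumset_triple:
  "hfold_sumset h {x, x + p, x + q} =
    (\<lambda>(i, j). int h * x + int i * p + int j * q) ` triangle (Suc h)"
proof (induction h)
  case 0
  have "triangle (Suc 0) = {(0, 0)}" by (auto simp: triangle_def)
  then show ?case by (simp add: hfold_sumset_0)
next
  case (Suc h)
  let ?F = "\<lambda>h (i, j). int h * x + int i * p + int j * q"
  show ?case
  proof (intro set_eqI iffI)
    fix y assume "y \<in> hfold_sumset (Suc h) {x, x + p, x + q}"
    then obtain i j a where ij: "i + j < Suc h" and a: "a \<in> {x, x + p, x + q}"
      and y: "y = int h * x + int i * p + int j * q + a"
      unfolding hfold_sumset_Suc Suc by (auto simp: triangle_def)
    from a consider "a = x" | "a = x + p" | "a = x + q" by auto
    then show "y \<in> ?F (Suc h) ` triangle (Suc (Suc h))"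
    proof cases
      case 1
      with ij y show ?thesis
        by (intro image_eqI[of _ _ "(i, j)"]) (auto simp: triangle_def algebra_simps)
    next
      case 2
      with ij y show ?thesis
        by (intro image_eqI[of _ _ "(Suc i, j)"]) (auto simp: triangle_def algebra_simps)
    next
      case 3
      with ij y show ?thesis
        by (intro image_eqI[of _ _ "(i, Suc j)"]) (auto simp: triangle_def algebra_simps)
    qed
  next
    fix y assume "y \<in> ?F (Suc h) ` triangle (Suc (Suc h))"
    then obtain i j where ij: "i + j < Suc (Suc h)" and y: "y = ?F (Suc h) (i, j)"
      by (auto simp: triangle_def)
    have step: "y \<in> hfold_sumset (Suc h) {x, x + p, x + q}"
      if "i' + j' < Suc h" "a \<in> {x, x + p, x + q}" "y = ?F h (i', j') + a" for i' j' a
      unfolding hfold_sumset_Suc Suc using that by (force simp: triangle_def)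
    \<comment> \<open>One summand has to be split off: x + p if i is positive, x + q if j is
      positive, and x at the origin, where every summand is x.\<close>
    consider i' where "i = Suc i'" | j' where "j = Suc j'" | "i = 0" "j = 0"
      by (cases i; cases j) auto
    then show "y \<in> hfold_sumset (Suc h) {x, x + p, x + q}"
    proof cases
      case 1
      with ij y show ?thesis by (intro step[of i' j "x + p"]) (auto simp: algebra_simps)
    next
      case 2
      with ij y show ?thesis by (intro step[of i j' "x + q"]) (auto simp: algebra_simps)
    next
      case 3
      with y show ?thesis by (intro step[of 0 0 x]) (auto simp: algebra_simps)
    qed
  qed
qed

lemma card_hfold_sumset_triple:
  fixes u v :: nat and x d :: int
  assumes "d \<noteq> 0" "u \<le> v" "0 < v" "coprime u v"
  shows "int (card (hfold_sumset h {x, x + d * int u, x + d * int v})) =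
    int ((h + 2) choose 2) - int (Suc (Suc h - v) choose 2)"
proof -
  let ?f = "\<lambda>(i, j). int h * x + int i * (d * int u) + int j * (d * int v)"
  let ?R = "{(i, j). i < v \<and> i + j < Suc h}"
  \<comment> \<open>Cancelling the common term h x and the nonzero factor d reduces collisions of
    \<open>?f\<close> to an equation in natural numbers.\<close>
  have f_eq: "?f (i, j) = ?f (i', j') \<longleftrightarrow> i * u + j * v = i' * u + j' * v" for i j i' j'
  proof -
    have "?f (i, j) = int h * x + d * int (i * u + j * v)" for i j
      by (simp add: algebra_simps)
    then show ?thesis using assms(1) by (simp del: of_nat_add of_nat_mult)
  qed
  have "?f ` triangle (Suc h) \<subseteq> ?f ` ?R"
  proof (rule image_subsetI)
    fix z assume "z \<in> triangle (Suc h)"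
    then obtain i j where z: "z = (i, j)" and ij: "i + j < Suc h"
      by (auto simp: triangle_def)
    \<comment> \<open>The exchange is made \<open>i div v\<close> times at once. Each exchange
      removes v from i and adds u \<le> v to j, so i + j does not grow.\<close>
    have "u * (i div v) \<le> v * (i div v)" using assms(2) by simp
    then have "i mod v + (j + u * (i div v)) \<le> i + j"
      using mult_div_mod_eq[of v i] by linarith
    then have "(i mod v, j + u * (i div v)) \<in> ?R"
      using ij assms(3) by auto
    moreover have "i * u + j * v = (i mod v) * u + (j + u * (i div v)) * v"
      by (subst mult_div_mod_eq[of v i, symmetric]) (simp only: algebra_simps)
    then have "?f (i, j) = ?f (i mod v, j + u * (i div v))"
      by (simp only: f_eq)
    ultimately show "?f z \<in> ?f ` ?R" unfolding z by (rule image_eqI[rotated])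
  qed
  moreover have "?R \<subseteq> triangle (Suc h)" by (auto simp: triangle_def)
  ultimately have "?f ` triangle (Suc h) = ?f ` ?R" by blast
  moreover have "inj_on ?f ?R"
  proof (rule inj_onI)
    fix z z' assume "z \<in> ?R" "z' \<in> ?R" and f: "?f z = ?f z'"
    then obtain i j i' j' where z: "z = (i, j)" "z' = (i', j')" and lt: "i < v" "i' < v"
      by auto
    have eq: "i * u + j * v = i' * u + j' * v" using f unfolding z by (simp only: f_eq)
    \<comment> \<open>In this form v visibly divides (i - i') u, hence i - i' by coprimality; since
      |i - i'| < v, this forces i = i', and then j = j' because v > 0.\<close>
    then have "int v * (int j' - int j) = (int i - int i') * int u"
      by (simp add: algebra_simps flip: of_nat_mult of_nat_add)
    then have "int v dvd (int i - int i') * int u" by (metis dvd_triv_left)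
    moreover have "coprime (int v) (int u)" using assms(4) by (simp add: coprime_commute)
    ultimately have "int v dvd int i - int i'" by (simp add: coprime_dvd_mult_left_iff)
    then have "i = i'" using lt zdvd_imp_le[of "int v" "\<bar>int i - int i'\<bar>"] by fastforce
    then show "z = z'" using z eq assms(3) by simp
  qed
  ultimately have "card (hfold_sumset h {x, x + d * int u, x + d * int v}) = card ?R"
    by (simp add: hfold_sumset_triple card_image)
  then show ?thesis
    using card_truncated_triangle[of v "Suc h"] by simp
qed

text \<open>Sort the elements, take the least as x, and divide the two positive differences from it
  by their gcd, which becomes d.\<close>

lemma card_3_normal_form:
  fixes A :: "int set"
  assumes "card A = 3"
  obtains x d :: int and u v :: nat
  where "A = {x, x + d * int u, x + d * int v}" "0 < d" "0 < u" "u < v" "coprime u v"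
proof -
  obtain a b c where "A = {a, b, c}" "distinct [a, b, c]"
    using assms by (auto simp: card_3_iff)
  then have "\<exists>x y z. A = {x, y, z} \<and> x < y \<and> y < z"
    by (smt (verit) distinct_length_2_or_more insert_commute)
  then obtain x y z where A: "A = {x, y, z}" "x < y" "y < z" by blast
  define p q where "p = nat (y - x)" and "q = nat (z - x)"
  have pq: "0 < p" "p < q" "y = x + int p" "z = x + int q"
    using A by (auto simp: p_def q_def)
  obtain u v where uv: "p = gcd p q * u" "q = gcd p q * v" "coprime u v"
    using gcd_coprime_exists[of p q] pq(1) by (metis gcd_eq_0_iff less_irrefl mult.commute)
  have "0 < gcd p q" using pq(1) by simp
  show ?thesis
  proof
    show "A = {x, x + int (gcd p q) * int u, x + int (gcd p q) * int v}"
      using A(1) pq(3,4) uv(1,2) by (metis of_nat_mult)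
    show "0 < int (gcd p q)" using \<open>0 < gcd p q\<close> by simp
    show "0 < u" using pq(1) uv(1) by (metis gr0I mult_0_right)
    show "u < v" using pq(2) uv(1,2) by (metis mult_less_cancel1)
  qed (rule uv(3))
qed

theorem theorem9:
  fixes h :: nat
  assumes "h \<ge> 1"
  shows "int ` sumset_sizes_int h 3 =
    {int ((h + 2) choose 2) - int (t choose 2) | t :: nat. t \<in> {1..h}}"
proof (intro set_eqI iffI)
  fix n assume "n \<in> int ` sumset_sizes_int h 3"
  then obtain A where "card A = 3" and n: "n = int (card (hfold_sumset h A))"
    by (auto simp: sumset_sizes_int_def)
  then obtain x d u v where A: "A = {x, x + d * int u, x + d * int v}"
    and "0 < d" "0 < u" "u < v" "coprime u v"
    by (metis card_3_normal_form)
  then have "n = int ((h + 2) choose 2) - int (Suc (Suc h - v) choose 2)"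
    unfolding n A by (intro card_hfold_sumset_triple) auto
  \<comment> \<open>From 0 < u < v follows v \<ge> 2, which gives the upper bound h; every v > h
    gives the value 1 by truncation.\<close>
  moreover have "Suc (Suc h - v) \<in> {1..h}"
    using assms \<open>0 < u\<close> \<open>u < v\<close> by auto
  ultimately show "n \<in> {int ((h + 2) choose 2) - int (t choose 2) | t. t \<in> {1..h}}"
    by blast
next
  fix n assume "n \<in> {int ((h + 2) choose 2) - int (t choose 2) | t. t \<in> {1..h}}"
  then obtain t where t: "1 \<le> t" "t \<le> h" and n: "n = int ((h + 2) choose 2) - int (t choose 2)"
    by auto
  \<comment> \<open>This solves t = h + 2 - v for v. Since t \<le> h, v is at least 2, so 0, 1, v
    are distinct, and u = 1 is coprime to v.\<close>
  define v where "v = h + 2 - t"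
  have v: "2 \<le> v" "Suc (Suc h - v) = t" using t by (auto simp: v_def)
  \<comment> \<open>The set {0, 1, v}, written to match \<open>card_hfold_sumset_triple\<close> with
    x = 0 and d = u = 1.\<close>
  let ?A = "{0, 0 + 1 * int 1, 0 + 1 * int v}"
  have "card ?A = 3" using v(1) by auto
  then have "card (hfold_sumset h ?A) \<in> sumset_sizes_int h 3"
    unfolding sumset_sizes_int_def by blast
  moreover have "int (card (hfold_sumset h ?A)) = n"
    using card_hfold_sumset_triple[of 1 1 v h 0] v n by simp
  ultimately show "n \<in> int ` sumset_sizes_int h 3" by blast
qed

end
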